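(* Let $X$ be a stratifiable topological space and let $X'$ be the subspace of non-isolated points of $X$. The function space $C_k(X)$ is Baire if and only if $X$ has the Moving Off Property and the function space $C_k(X')$ is Baire.
   Context: $C_k(X)$ is the space of continuous real-valued functions on $X$ endowed with the compact-open topology. A topological space is Baire if the intersection of any sequence of open dense subsets is dense. A point $x\in X$ is isolated if $\{x\}$ is clopen in $X$; $X'$ is the set of non-isolated points of $X$. Stratifiable: a regular space $X$ (regular spaces are understood to be $T_1$) is stratifiable if to each $x\in X$ one can assign a decreasing sequence $(U_n(x))_{n\in\omega}$ of neighborhoods of $x$ such that each closed set $F\subset X$ equals $\bigcap_{n\in\omega}\overline{U_n[F]}$, where $U_n[F]=\bigcup_{x\in F}U_n(x)$. Moving Off Property: a family $\mathcal F$ of subsets of $X$ is a moving off family if for any compact $K\subset X$ there is a non-empty $F\in\mathcal F$ with $K\cap F=\emptyset$. A family $\mathcal F$ is strongly discrete if each $F\in\mathcal F$ has an open neighborhood $O_F\subset X$ such that the indexed family $\{O_F\}_{F\in\mathcal F}$ is discrete, i.e. each $x\in X$ has a neighborhood meeting $O_F$ for at most one index $F\in\mathcal F$. $X$ has the Moving Off Property if each moving off family of compact subsets of $X$ contains an infinite strongly discrete subfamily. *)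

theory Defs
  imports "HOL-Analysis.Analysis"
begin

definition neighborhood_in :: "'a topology \<Rightarrow> 'a \<Rightarrow> 'a set \<Rightarrow> bool" where
  "neighborhood_in X x N \<longleftrightarrow>
     N \<subseteq> topspace X \<and> (\<exists>V. openin X V \<and> x \<in> V \<and> V \<subseteq> N)"

text \<open>Regular spaces are understood to be \<open>T\<^sub>1\<close>, which the library's
  \<^const>\<open>regular_space\<close> does not include. The neighborhoods \<open>U n x\<close> need not be open.\<close>

definition stratifiable_space :: "'a topology \<Rightarrow> bool" where
  "stratifiable_space X \<longleftrightarrow>
     regular_space X \<and> t1_space X \<and>
     (\<exists>U :: nat \<Rightarrow> 'a \<Rightarrow> 'a set.
        (\<forall>x \<in> topspace X. \<forall>n. neighborhood_in X x (U n x) \<and> U (Suc n) x \<subseteq> U n x) \<and>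
        (\<forall>F. closedin X F \<longrightarrow> F = (\<Inter>n. X closure_of (\<Union>x\<in>F. U n x))))"

definition isolated_point_in :: "'a topology \<Rightarrow> 'a \<Rightarrow> bool" where
  "isolated_point_in X x \<longleftrightarrow> x \<in> topspace X \<and> openin X {x} \<and> closedin X {x}"

definition nonisolated_subspace :: "'a topology \<Rightarrow> 'a topology" where
  "nonisolated_subspace X = subtopology X {x \<in> topspace X. \<not> isolated_point_in X x}"

text \<open>Points of the function space are continuous functions on \<^term>\<open>topspace X\<close>; requiring
  them to be \<^const>\<open>extensional\<close> makes each such function have exactly one representative.\<close>

definition real_continuous_functions :: "'a topology \<Rightarrow> ('a \<Rightarrow> real) set" where
  "real_continuous_functions X =
     {f \<in> extensional (topspace X). continuous_map X euclideanreal f}"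

definition Ck_space :: "'a topology \<Rightarrow> ('a \<Rightarrow> real) topology" where
  "Ck_space X = topology_generated_by
     {{f \<in> real_continuous_functions X. f ` K \<subseteq> V} | K V. compactin X K \<and> open V}"

lemma topspace_Ck_space: "topspace (Ck_space X) = real_continuous_functions X"
proof -
  have "real_continuous_functions X = {f \<in> real_continuous_functions X. f ` {} \<subseteq> (UNIV :: real set)}"
    by simp
  then have "real_continuous_functions X
      \<in> {{f \<in> real_continuous_functions X. f ` K \<subseteq> V} | K V. compactin X K \<and> open V}"
    using compactin_empty open_UNIV by blast
  then show ?thesis
    unfolding Ck_space_def topology_generated_by_topspace by blast
qed

definition Baire_space :: "'a topology \<Rightarrow> bool" where
  "Baire_space X \<longleftrightarrow>
     (\<forall>G :: nat \<Rightarrow> 'a set.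
        (\<forall>n. openin X (G n) \<and> X closure_of (G n) = topspace X) \<longrightarrow>
        X closure_of (\<Inter>n. G n) = topspace X)"

definition moving_off_family :: "'a topology \<Rightarrow> 'a set set \<Rightarrow> bool" where
  "moving_off_family X \<F> \<longleftrightarrow>
     (\<forall>F \<in> \<F>. F \<subseteq> topspace X) \<and>
     (\<forall>K. compactin X K \<longrightarrow> (\<exists>F \<in> \<F>. F \<noteq> {} \<and> K \<inter> F = {}))"

definition strongly_discrete_family :: "'a topology \<Rightarrow> 'a set set \<Rightarrow> bool" where
  "strongly_discrete_family X \<F> \<longleftrightarrow>
     (\<exists>O\<^sub>F :: 'a set \<Rightarrow> 'a set.
        (\<forall>F \<in> \<F>. openin X (O\<^sub>F F) \<and> F \<subseteq> O\<^sub>F F) \<and>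
        (\<forall>x \<in> topspace X. \<exists>N. neighborhood_in X x N \<and>
           (\<forall>F \<in> \<F>. \<forall>F' \<in> \<F>. N \<inter> O\<^sub>F F \<noteq> {} \<longrightarrow> N \<inter> O\<^sub>F F' \<noteq> {} \<longrightarrow> F = F')))"

definition moving_off_property :: "'a topology \<Rightarrow> bool" where
  "moving_off_property X \<longleftrightarrow>
     (\<forall>\<F>. moving_off_family X \<F> \<and> (\<forall>F \<in> \<F>. compactin X F) \<longrightarrow>
        (\<exists>\<G> \<subseteq> \<F>. infinite \<G> \<and> strongly_discrete_family X \<G>))"

end

theory Submission
  imports Defs
begin

text \<open>For stratifiable \<open>X\<close> the space \<open>C\<^sub>k(X)\<close> is Baire if and only if \<open>X\<close> has the Moving Off Property.
  Since stratifiability and the Moving Off Property pass to the closed subspace \<open>X'\<close>, the Baire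
  property of \<open>C\<^sub>k(X')\<close> is then automatic.

  If \<open>C\<^sub>k(X)\<close> is Baire and \<open>\<F>\<close> is a moving off family of compact sets, then a generic function
  exceeds every \<open>n\<close> on some nonempty member of \<open>\<F>\<close>, and preimages of separated intervals
  witness strong discreteness.

  Conversely, given dense open sets \<open>G\<^sub>n\<close>, one builds balls \<open>{f. \<bar>f - p\<^sub>n\<bar> < e\<^sub>n on K\<^sub>n}\<close>, each
  after the first contained in the previous dense open set, where \<open>p\<^sub>n\<^sub>+\<^sub>1\<close> is uniformly close to
  \<open>p\<^sub>n\<close> except near a compact set \<open>A\<^sub>n\<close> disjoint from \<open>K\<^sub>n\<close>. The functions \<open>p\<^sub>n\<close> converge to a
  continuous function as soon as the exceptional neighborhoods are locally finite; in a stratifiable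
  space discreteness of \<open>(A\<^sub>n)\<close> is enough for this. A branch with \<open>(A\<^sub>n)\<close> discrete is found by
  applying the Moving Off Property first at every node of the tree of all choices, which makes this
  tree countable, and then once more to finite unions of the resulting sets.\<close>

section \<open>Stratifiable spaces\<close>

definition stratification :: "'a topology \<Rightarrow> (nat \<Rightarrow> 'a \<Rightarrow> 'a set) \<Rightarrow> bool" where
  "stratification X U \<longleftrightarrow>
     (\<forall>x \<in> topspace X. \<forall>n. neighborhood_in X x (U n x) \<and> U (Suc n) x \<subseteq> U n x) \<and>
     (\<forall>F. closedin X F \<longrightarrow> F = (\<Inter>n. X closure_of (\<Union>x\<in>F. U n x)))"

lemma stratifiable_spaceE:
  assumes "stratifiable_space X"
  obtains U where "stratification X U"
  using assms unfolding stratifiable_space_def stratification_def by blast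

lemma stratification_antimono:
  assumes "stratification X U" "A \<subseteq> topspace X" "m \<le> n"
  shows "(\<Union>x\<in>A. U n x) \<subseteq> (\<Union>x\<in>A. U m x)"
proof -
  have "U n x \<subseteq> U m x" if "x \<in> A" for x
    using assms that lift_Suc_antimono_le[of "\<lambda>n. U n x", OF _ \<open>m \<le> n\<close>]
    unfolding stratification_def by blast
  then show ?thesis by blast
qed

text \<open>The sets \<open>U n x\<close> need not be open, so an open core is chosen at each point
  of \<open>A\<close> and the cores are united.\<close>

lemma stratification_interior:
  assumes "stratification X U" "A \<subseteq> topspace X"
  obtains W where "openin X W" "A \<subseteq> W" "W \<subseteq> (\<Union>x\<in>A. U n x)"
proof -
  have "\<forall>x\<in>A. \<exists>V. openin X V \<and> x \<in> V \<and> V \<subseteq> U n x"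
    using assms unfolding stratification_def neighborhood_in_def by blast
  then obtain V where "\<forall>x\<in>A. openin X (V x) \<and> x \<in> V x \<and> V x \<subseteq> U n x" by metis
  then show ?thesis
    by (intro that[of "\<Union>x\<in>A. V x"]) auto
qed

lemma stratification_separates:
  assumes "stratification X U" "closedin X A" "x \<notin> A"
  obtains n where "x \<notin> X closure_of (\<Union>x\<in>A. U n x)"
proof -
  have "A = (\<Inter>n. X closure_of (\<Union>x\<in>A. U n x))"
    using assms unfolding stratification_def by blast
  then show ?thesis using \<open>x \<notin> A\<close> that by blast
qed

text \<open>From an open core of the \<open>n\<close>-th expansion of each set one removes the
  closure of the \<open>n\<close>-th expansion of the other. Every point survives for some
  \<open>n\<close>, because the closed expansions of a closed set intersect in that set.\<close>

lemma stratifiable_imp_normal_space: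
  assumes "stratifiable_space X"
  shows "normal_space X"
  unfolding normal_space_def
proof (intro allI impI, elim conjE)
  fix A B
  assume A: "closedin X A" and B: "closedin X B" and AB: "disjnt A B"
  obtain U where U: "stratification X U" using stratifiable_spaceE[OF assms] .
  have Asub: "A \<subseteq> topspace X" and Bsub: "B \<subseteq> topspace X"
    using A B closedin_subset by auto
  define S where "S C n = X closure_of (\<Union>x\<in>C. U n x)" for C n
  have U_sub: "U n x \<subseteq> topspace X" if "x \<in> topspace X" for n x
    using U that unfolding stratification_def neighborhood_in_def by blast
  have S_sub: "(\<Union>x\<in>C. U n x) \<subseteq> S C n" if "C \<subseteq> topspace X" for C n
    unfolding S_def by (rule closure_of_subset) (use U_sub that in blast)
  have "\<exists>V. openin X V \<and> A \<subseteq> V \<and> V \<subseteq> (\<Union>x\<in>A. U n x)" for n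
    by (rule stratification_interior[OF U Asub]) blast
  then obtain V where V: "\<And>n. openin X (V n) \<and> A \<subseteq> V n \<and> V n \<subseteq> (\<Union>x\<in>A. U n x)" by metis
  have "\<exists>W. openin X W \<and> B \<subseteq> W \<and> W \<subseteq> (\<Union>x\<in>B. U n x)" for n
    by (rule stratification_interior[OF U Bsub]) blast
  then obtain W where W: "\<And>n. openin X (W n) \<and> B \<subseteq> W n \<and> W n \<subseteq> (\<Union>x\<in>B. U n x)" by metis
  have clo: "closedin X (S C n)" for C n unfolding S_def by simp
  show "\<exists>P Q. openin X P \<and> openin X Q \<and> A \<subseteq> P \<and> B \<subseteq> Q \<and> disjnt P Q"
  proof (intro exI conjI)
    show "openin X (\<Union>n. V n - S B n)" "openin X (\<Union>n. W n - S A n)"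
      using V W clo by (auto intro!: openin_Union openin_diff)
    show "A \<subseteq> (\<Union>n. V n - S B n)"
    proof
      fix x assume x: "x \<in> A"
      then have "x \<notin> B" using AB by (auto simp: disjnt_def)
      then obtain n where "x \<notin> S B n"
        using stratification_separates[OF U B] unfolding S_def by metis
      then show "x \<in> (\<Union>n. V n - S B n)" using V x by blast
    qed
    show "B \<subseteq> (\<Union>n. W n - S A n)"
    proof
      fix x assume x: "x \<in> B"
      then have "x \<notin> A" using AB by (auto simp: disjnt_def)
      then obtain n where "x \<notin> S A n"
        using stratification_separates[OF U A] unfolding S_def by metis
      then show "x \<in> (\<Union>n. W n - S A n)" using W x by blast
    qed
    \<comment> \<open>The smaller index decides: expansions decrease, so a point of the core with
      the larger index already lies in the closed set removed at the smaller one.\<close>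
    have False if x: "x \<in> V n" "x \<notin> S B n" "x \<in> W m" "x \<notin> S A m" for x n m
    proof (cases "n \<le> m")
      case True
      have "x \<in> (\<Union>x\<in>B. U m x)" using W[of m] x(3) by (meson subsetD)
      then have "x \<in> (\<Union>x\<in>B. U n x)"
        using stratification_antimono[OF U Bsub \<open>n \<le> m\<close>] by (meson subsetD)
      then show False using S_sub[OF Bsub] x(2) by (meson subsetD)
    next
      case False
      then have "m \<le> n" by simp
      have "x \<in> (\<Union>x\<in>A. U n x)" using V[of n] x(1) by (meson subsetD)
      then have "x \<in> (\<Union>x\<in>A. U m x)"
        using stratification_antimono[OF U Asub \<open>m \<le> n\<close>] by (meson subsetD)
      then show False using S_sub[OF Asub] x(4) by (meson subsetD)
    qed
    then show "disjnt (\<Union>n. V n - S B n) (\<Union>n. W n - S A n)"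
      unfolding disjnt_def by blast
  qed
qed

lemma stratifiable_imp_Hausdorff_space:
  "stratifiable_space X \<Longrightarrow> Hausdorff_space X"
  unfolding stratifiable_space_def by (simp add: regular_t1_imp_Hausdorff_space)

lemma neighborhood_in_subtopology:
  assumes "neighborhood_in X x N" "x \<in> S"
  shows "neighborhood_in (subtopology X S) x (N \<inter> S)"
proof -
  obtain V where "openin X V" "x \<in> V" "V \<subseteq> N" "N \<subseteq> topspace X"
    using assms unfolding neighborhood_in_def by blast
  then show ?thesis
    unfolding neighborhood_in_def using assms
    by (intro conjI exI[of _ "V \<inter> S"]) (auto simp: openin_subtopology)
qed

text \<open>The stratification is cut down to \<open>S\<close>. A closed set of the subspace is
  closed in \<open>X\<close>, and closures in the subspace lie inside closures in \<open>X\<close>,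
  so the intersection cannot exceed \<open>F\<close>.\<close>

lemma stratifiable_space_closed_subtopology:
  assumes "stratifiable_space X" "closedin X S"
  shows "stratifiable_space (subtopology X S)"
proof -
  obtain U where U: "stratification X U" using stratifiable_spaceE[OF assms(1)] .
  define T where "T n x = U n x \<inter> S" for n x
  have "F = (\<Inter>n. subtopology X S closure_of (\<Union>x\<in>F. T n x))"
    if F: "closedin (subtopology X S) F" for F
  proof
    have FX: "closedin X F" using F assms(2) closedin_trans_full by blast
    have FS: "F \<subseteq> S" "F \<subseteq> topspace X"
      using closedin_subset[OF F] by (auto simp: topspace_subtopology)
    have nb: "neighborhood_in X x (U n x)" if "x \<in> F" for n x
      using U that FS unfolding stratification_def by blast
    show "F \<subseteq> (\<Inter>n. subtopology X S closure_of (\<Union>x\<in>F. T n x))"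
    proof (rule INT_greatest)
      fix n
      have "F \<subseteq> (\<Union>x\<in>F. T n x)"
        using nb FS unfolding neighborhood_in_def T_def by blast
      moreover have "(\<Union>x\<in>F. T n x) \<subseteq> topspace (subtopology X S)"
        using nb unfolding neighborhood_in_def T_def by (auto simp: topspace_subtopology)
      ultimately show "F \<subseteq> subtopology X S closure_of (\<Union>x\<in>F. T n x)"
        using closure_of_subset by (metis order_trans)
    qed
    have "subtopology X S closure_of (\<Union>x\<in>F. T n x) \<subseteq> X closure_of (\<Union>x\<in>F. U n x)" for n
    proof -
      have "subtopology X S closure_of (\<Union>x\<in>F. T n x) \<subseteq> X closure_of (\<Union>x\<in>F. T n x)"
        by (simp add: closure_of_subtopology_subset)
      also have "\<dots> \<subseteq> X closure_of (\<Union>x\<in>F. U n x)"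
        by (rule closure_of_mono) (auto simp: T_def)
      finally show ?thesis .
    qed
    then have "(\<Inter>n. subtopology X S closure_of (\<Union>x\<in>F. T n x)) \<subseteq> (\<Inter>n. X closure_of (\<Union>x\<in>F. U n x))"
      by (rule INF_mono')
    also have "(\<Inter>n. X closure_of (\<Union>x\<in>F. U n x)) = F"
      using U FX unfolding stratification_def by blast
    finally show "(\<Inter>n. subtopology X S closure_of (\<Union>x\<in>F. T n x)) \<subseteq> F" .
  qed
  moreover have "neighborhood_in (subtopology X S) x (T n x) \<and> T (Suc n) x \<subseteq> T n x"
    if "x \<in> topspace (subtopology X S)" for n x
    using that U neighborhood_in_subtopology[of X x "U n x" S]
    unfolding stratification_def T_def by (auto simp: topspace_subtopology)
  moreover have "regular_space (subtopology X S)" "t1_space (subtopology X S)"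
    using assms(1) unfolding stratifiable_space_def
    by (simp_all add: regular_space_subtopology t1_space_subtopology)
  ultimately show ?thesis
    unfolding stratifiable_space_def by (intro conjI exI[of _ T] ballI allI impI) auto
qed

section \<open>The Moving Off Property\<close>

lemma strongly_discrete_familyE:
  assumes "strongly_discrete_family X \<G>"
  obtains P where "\<And>F. F \<in> \<G> \<Longrightarrow> openin X (P F)" "\<And>F. F \<in> \<G> \<Longrightarrow> F \<subseteq> P F"
    "\<And>x. x \<in> topspace X \<Longrightarrow> \<exists>V. openin X V \<and> x \<in> V \<and>
       (\<forall>F\<in>\<G>. \<forall>F'\<in>\<G>. V \<inter> P F \<noteq> {} \<longrightarrow> V \<inter> P F' \<noteq> {} \<longrightarrow> F = F')"
proof -
  obtain P where P: "\<forall>F\<in>\<G>. openin X (P F) \<and> F \<subseteq> P F"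
    and N: "\<forall>x\<in>topspace X. \<exists>N. neighborhood_in X x N \<and>
       (\<forall>F\<in>\<G>. \<forall>F'\<in>\<G>. N \<inter> P F \<noteq> {} \<longrightarrow> N \<inter> P F' \<noteq> {} \<longrightarrow> F = F')"
    using assms unfolding strongly_discrete_family_def by (elim exE conjE) (rule that)
  show thesis
  proof (rule that)
    fix x assume "x \<in> topspace X"
    then obtain N where N: "neighborhood_in X x N"
      "\<forall>F\<in>\<G>. \<forall>F'\<in>\<G>. N \<inter> P F \<noteq> {} \<longrightarrow> N \<inter> P F' \<noteq> {} \<longrightarrow> F = F'"
      using bspec[OF N, of x] by (elim meta_impE exE conjE)
    then obtain V where V: "openin X V" "x \<in> V" "V \<subseteq> N"
      unfolding neighborhood_in_def by blast
    have "\<forall>F\<in>\<G>. \<forall>F'\<in>\<G>. V \<inter> P F \<noteq> {} \<longrightarrow> V \<inter> P F' \<noteq> {} \<longrightarrow> F = F'"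
    proof (intro ballI impI)
      fix F F' assume F: "F \<in> \<G>" "F' \<in> \<G>" "V \<inter> P F \<noteq> {}" "V \<inter> P F' \<noteq> {}"
      then have "N \<inter> P F \<noteq> {}" "N \<inter> P F' \<noteq> {}" using V(3) by blast+
      then show "F = F'" using N(2) F(1,2) by simp
    qed
    then show "\<exists>V. openin X V \<and> x \<in> V \<and>
       (\<forall>F\<in>\<G>. \<forall>F'\<in>\<G>. V \<inter> P F \<noteq> {} \<longrightarrow> V \<inter> P F' \<noteq> {} \<longrightarrow> F = F')"
      using V by (intro exI[of _ V] conjI)
  qed (use P in auto)
qed

lemma moving_off_propertyE:
  assumes "moving_off_property X" "moving_off_family X \<F>" "\<And>F. F \<in> \<F> \<Longrightarrow> compactin X F"
  obtains \<G> where "\<G> \<subseteq> \<F>" "infinite \<G>" "strongly_discrete_family X \<G>"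
proof -
  have "\<exists>\<G>\<subseteq>\<F>. infinite \<G> \<and> strongly_discrete_family X \<G>"
    using assms unfolding moving_off_property_def by simp
  then show thesis by (elim exE conjE) (rule that)
qed

text \<open>A compact set of \<open>X\<close> meets the closed set \<open>S\<close> in a compact
  set, so a moving off family of the subspace also moves off in \<open>X\<close>. Discreteness then
  restricts to \<open>S\<close>.\<close>

lemma moving_off_property_closed_subtopology:
  assumes MOP: "moving_off_property X" and S: "closedin X S"
  shows "moving_off_property (subtopology X S)"
  unfolding moving_off_property_def
proof (intro allI impI, elim conjE)
  fix \<F>
  assume mov: "moving_off_family (subtopology X S) \<F>"
    and comp: "\<forall>F\<in>\<F>. compactin (subtopology X S) F"
  have sub: "F \<subseteq> S" "compactin X F" if "F \<in> \<F>" for F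
    using comp that by (auto simp: compactin_subtopology)
  have "moving_off_family X \<F>"
    unfolding moving_off_family_def
  proof (intro conjI ballI allI impI)
    show "F \<subseteq> topspace X" if "F \<in> \<F>" for F
      using sub(2)[OF that] compactin_subset_topspace by blast
    fix K assume "compactin X K"
    then have "compactin (subtopology X S) (S \<inter> K)"
      using S by (simp add: compactin_subtopology closed_Int_compactin)
    then obtain F where "F \<in> \<F>" "F \<noteq> {}" "S \<inter> K \<inter> F = {}"
      using mov unfolding moving_off_family_def by blast
    then show "\<exists>F\<in>\<F>. F \<noteq> {} \<and> K \<inter> F = {}" using sub by blast
  qed
  then obtain \<G> where G: "\<G> \<subseteq> \<F>" "infinite \<G>" "strongly_discrete_family X \<G>"
    using moving_off_propertyE[OF MOP _ sub(2)] by metis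
  obtain P where P: "\<And>F. F \<in> \<G> \<Longrightarrow> openin X (P F)" "\<And>F. F \<in> \<G> \<Longrightarrow> F \<subseteq> P F"
    and N: "\<And>x. x \<in> topspace X \<Longrightarrow> \<exists>V. openin X V \<and> x \<in> V \<and>
       (\<forall>F\<in>\<G>. \<forall>F'\<in>\<G>. V \<inter> P F \<noteq> {} \<longrightarrow> V \<inter> P F' \<noteq> {} \<longrightarrow> F = F')"
    using strongly_discrete_familyE[OF G(3)] by metis
  have "strongly_discrete_family (subtopology X S) \<G>"
    unfolding strongly_discrete_family_def
  proof (intro exI[of _ "\<lambda>F. P F \<inter> S"] conjI ballI)
    fix F assume F: "F \<in> \<G>"
    then show "openin (subtopology X S) (P F \<inter> S)"
      using P(1) by (auto simp: openin_subtopology)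
    have "F \<subseteq> S" using F G(1) sub(1) by blast
    then show "F \<subseteq> P F \<inter> S" using P(2)[OF F] by blast
  next
    fix x assume "x \<in> topspace (subtopology X S)"
    then have x: "x \<in> topspace X" "x \<in> S" by (auto simp: topspace_subtopology)
    then obtain V where V: "openin X V" "x \<in> V"
      "\<forall>F\<in>\<G>. \<forall>F'\<in>\<G>. V \<inter> P F \<noteq> {} \<longrightarrow> V \<inter> P F' \<noteq> {} \<longrightarrow> F = F'"
      using N by metis
    have "neighborhood_in X x V"
      unfolding neighborhood_in_def using V(1,2) openin_subset[OF V(1)] by (intro conjI exI[of _ V]) auto
    then have "neighborhood_in (subtopology X S) x (V \<inter> S)"
      using neighborhood_in_subtopology x(2) by metis
    moreover have "\<forall>F\<in>\<G>. \<forall>F'\<in>\<G>.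
        (V \<inter> S) \<inter> (P F \<inter> S) \<noteq> {} \<longrightarrow> (V \<inter> S) \<inter> (P F' \<inter> S) \<noteq> {} \<longrightarrow> F = F'"
    proof (intro ballI impI)
      fix F F' assume F: "F \<in> \<G>" "F' \<in> \<G>" "(V \<inter> S) \<inter> (P F \<inter> S) \<noteq> {}" "(V \<inter> S) \<inter> (P F' \<inter> S) \<noteq> {}"
      then have "V \<inter> P F \<noteq> {}" "V \<inter> P F' \<noteq> {}" by auto
      then show "F = F'" using V(3) F(1,2) by simp
    qed
    ultimately show "\<exists>N. neighborhood_in (subtopology X S) x N \<and> (\<forall>F\<in>\<G>. \<forall>F'\<in>\<G>.
        N \<inter> (P F \<inter> S) \<noteq> {} \<longrightarrow> N \<inter> (P F' \<inter> S) \<noteq> {} \<longrightarrow> F = F')"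
      by (intro exI[of _ "V \<inter> S"] conjI)
  qed
  then show "\<exists>\<G>\<subseteq>\<F>. infinite \<G> \<and> strongly_discrete_family (subtopology X S) \<G>"
    using G by blast
qed

text \<open>Every point has an open neighborhood meeting at most one member, and finitely many of
  these cover \<open>K\<close>.\<close>

lemma strongly_discrete_compact_finite:
  assumes "strongly_discrete_family X \<G>" "compactin X K"
  shows "finite {F \<in> \<G>. K \<inter> F \<noteq> {}}"
proof -
  obtain P where P: "\<And>F. F \<in> \<G> \<Longrightarrow> F \<subseteq> P F"
    and N: "\<And>x. x \<in> topspace X \<Longrightarrow> \<exists>V. openin X V \<and> x \<in> V \<and>
       (\<forall>F\<in>\<G>. \<forall>F'\<in>\<G>. V \<inter> P F \<noteq> {} \<longrightarrow> V \<inter> P F' \<noteq> {} \<longrightarrow> F = F')"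
    using strongly_discrete_familyE[OF assms(1)] by metis
  define \<U> where "\<U> = {V. openin X V \<and> finite {F \<in> \<G>. V \<inter> F \<noteq> {}}}"
  have "K \<subseteq> \<Union>\<U>"
  proof
    fix x assume "x \<in> K"
    then have "x \<in> topspace X" using compactin_subset_topspace[OF assms(2)] by blast
    then obtain V where V: "openin X V" "x \<in> V"
      "\<forall>F\<in>\<G>. \<forall>F'\<in>\<G>. V \<inter> P F \<noteq> {} \<longrightarrow> V \<inter> P F' \<noteq> {} \<longrightarrow> F = F'"
      using N by metis
    have "F = F'" if F: "F \<in> \<G>" "F' \<in> \<G>" "V \<inter> F \<noteq> {}" "V \<inter> F' \<noteq> {}" for F F'
    proof -
      have "V \<inter> P F \<noteq> {}" "V \<inter> P F' \<noteq> {}" using F P by blast+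
      then show ?thesis using V(3) F(1,2) by simp
    qed
    then have "{F \<in> \<G>. V \<inter> F \<noteq> {}} \<subseteq> {F0}" if "F0 \<in> \<G>" "V \<inter> F0 \<noteq> {}" for F0
      using that by blast
    then have "finite {F \<in> \<G>. V \<inter> F \<noteq> {}}"
      by (metis (mono_tags, lifting) Collect_empty_eq finite.emptyI finite.insertI finite_subset)
    then show "x \<in> \<Union>\<U>" unfolding \<U>_def using V by auto
  qed
  then obtain \<V> where \<V>: "finite \<V>" "\<V> \<subseteq> \<U>" "K \<subseteq> \<Union>\<V>"
    using compactinD[OF assms(2), of \<U>] unfolding \<U>_def by auto
  then have "\<forall>V\<in>\<V>. finite {F \<in> \<G>. V \<inter> F \<noteq> {}}" unfolding \<U>_def by auto
  then have "finite (\<Union>V\<in>\<V>. {F \<in> \<G>. V \<inter> F \<noteq> {}})" using \<V>(1) by simp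
  moreover have "{F \<in> \<G>. K \<inter> F \<noteq> {}} \<subseteq> (\<Union>V\<in>\<V>. {F \<in> \<G>. V \<inter> F \<noteq> {}})"
    using \<V>(3) by blast
  ultimately show ?thesis using finite_subset by blast
qed

text \<open>The sets \<open>F (m # t)\<close>, \<open>m \<in> \<nat>\<close>, are the children of the node \<open>t\<close> of an \<open>\<omega>\<close>-branching tree.
  The Moving Off Property gives information about one family only, so the choices at the first
  \<open>k\<close> nodes are merged into a single compact set, labelled by \<open>k\<close>. Adding the set \<open>F (k # t\<^sub>0)\<close>
  makes different members of a discrete subfamily carry different labels, so that the labels
  are unbounded and a branch can be read off.\<close>

lemma moving_off_property_branch:
  fixes F :: "nat list \<Rightarrow> 'a set"
  assumes MOP: "moving_off_property X"
    and comp: "\<And>t. compactin X (F t)"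
    and fin: "\<And>t L. compactin X L \<Longrightarrow> finite {m. L \<inter> F (m # t) \<noteq> {}}"
  obtains b where "b 0 = []" "\<And>n. \<exists>m. b (Suc n) = m # b n"
    "\<And>x. x \<in> topspace X \<Longrightarrow> \<exists>N. openin X N \<and> x \<in> N \<and> finite {n. N \<inter> F (b (Suc n)) \<noteq> {}}"
proof (cases "\<forall>t. \<exists>m. F (m # t) = {}")
  case True
  \<comment> \<open>Following empty children forever makes local finiteness trivial.\<close>
  then obtain g where g: "\<And>t. F (g t # t) = {}" by metis
  define b where "b = rec_nat [] (\<lambda>_ t. g t # t)"
  have "F (b (Suc n)) = {}" for n by (simp add: b_def g)
  then show ?thesis
    by (intro that[of b]) (auto simp: b_def)
next
  case False
  \<comment> \<open>All children of \<open>t0\<close> carry non-empty sets; they serve as markers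
    for the labels.\<close>
  then obtain t0 where t0: "\<And>m. F (m # t0) \<noteq> {}" by blast
  define I where "I k = {t :: nat list. to_nat t \<le> k}" for k
  have finI: "finite (I k)" for k
    unfolding I_def using finite_vimageI[of "{..k}" "to_nat :: nat list \<Rightarrow> nat"]
    by (simp add: vimage_def)
  define E where "E k \<sigma> = F (k # t0) \<union> (\<Union>t\<in>I k. F (\<sigma> t # t))" for k \<sigma>
  define \<E> where "\<E> = {E k \<sigma> | k \<sigma>. True}"
  have comp_E: "compactin X (E k \<sigma>)" for k \<sigma>
    unfolding E_def using comp finI by (intro compactin_Un compactin_Union) auto
  have "moving_off_family X \<E>"
    unfolding moving_off_family_def
  proof (intro conjI ballI allI impI)
    fix A assume "A \<in> \<E>"
    then show "A \<subseteq> topspace X" using comp_E compactin_subset_topspace \<E>_def by blast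
  next
    fix L assume L: "compactin X L"
    have "\<exists>m. L \<inter> F (m # t) = {}" for t
      using ex_new_if_finite[OF infinite_UNIV_nat fin[OF L, of t]] by auto
    then obtain \<sigma> where \<sigma>: "\<And>t. L \<inter> F (\<sigma> t # t) = {}" by metis
    \<comment> \<open>The label is taken to be \<open>\<sigma> t0\<close>, so that the marker avoids
      \<open>L\<close> as well.\<close>
    have "L \<inter> E (\<sigma> t0) \<sigma> = {}" "E (\<sigma> t0) \<sigma> \<noteq> {}"
      using \<sigma> t0 unfolding E_def by blast+
    then show "\<exists>A\<in>\<E>. A \<noteq> {} \<and> L \<inter> A = {}" unfolding \<E>_def by blast
  qed
  then obtain \<G> where G: "\<G> \<subseteq> \<E>" "infinite \<G>" "strongly_discrete_family X \<G>"
    using moving_off_propertyE[OF MOP, of \<E>] comp_E unfolding \<E>_def by blast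
  obtain P where P: "\<And>A. A \<in> \<G> \<Longrightarrow> openin X (P A)" "\<And>A. A \<in> \<G> \<Longrightarrow> A \<subseteq> P A"
    and N: "\<And>x. x \<in> topspace X \<Longrightarrow> \<exists>V. openin X V \<and> x \<in> V \<and>
       (\<forall>A\<in>\<G>. \<forall>A'\<in>\<G>. V \<inter> P A \<noteq> {} \<longrightarrow> V \<inter> P A' \<noteq> {} \<longrightarrow> A = A')"
    using strongly_discrete_familyE[OF G(3)] by metis
  have "\<forall>A\<in>\<G>. \<exists>k \<sigma>. A = E k \<sigma>" using G unfolding \<E>_def by blast
  then obtain lab sg where lab: "\<And>A. A \<in> \<G> \<Longrightarrow> A = E (lab A) (sg A)" by metis
  have meet: "A = A'" if A: "A \<in> \<G>" "A' \<in> \<G>" and x: "x \<in> A" "x \<in> A'" for A A' x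
  proof -
    have "x \<in> topspace X" using P A x openin_subset by blast
    then obtain V where V: "x \<in> V"
      "\<forall>A\<in>\<G>. \<forall>A'\<in>\<G>. V \<inter> P A \<noteq> {} \<longrightarrow> V \<inter> P A' \<noteq> {} \<longrightarrow> A = A'"
      using N by metis
    have "V \<inter> P A \<noteq> {}" "V \<inter> P A' \<noteq> {}" using A x P(2) V(1) by blast+
    then show ?thesis using V(2) A by simp
  qed
  have "inj_on lab \<G>"
  proof (rule inj_onI)
    fix A A' assume A: "A \<in> \<G>" "A' \<in> \<G>" "lab A = lab A'"
    obtain x where "x \<in> F (lab A # t0)" using t0 by blast
    then have "x \<in> A" "x \<in> A'" using lab[OF A(1)] lab[OF A(2)] A(3) unfolding E_def by auto
    then show "A = A'" using meet A by blast
  qed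
  then have "infinite (lab ` \<G>)" using G(2) finite_imageD by blast
  then have big: "\<exists>A\<in>\<G>. lab A \<ge> n" for n
    unfolding infinite_nat_iff_unbounded_le by blast
  \<comment> \<open>Pairs of a node and a member of \<open>\<G>\<close> are built together. The code
    of the node is at most the label of the member, so this member prescribes a child of the node
    and contains its set. Strictly increasing labels keep the members distinct along the branch, and
    discreteness of \<open>\<G>\<close> passes to the branch.\<close>
  have "\<exists>f. \<forall>n. (snd (f n) \<in> \<G> \<and> to_nat (fst (f n)) \<le> lab (snd (f n)) \<and> (n = 0 \<longrightarrow> fst (f n) = []))
      \<and> ((\<exists>m. fst (f (Suc n)) = m # fst (f n)) \<and> F (fst (f (Suc n))) \<subseteq> snd (f n)
          \<and> lab (snd (f n)) < lab (snd (f (Suc n))))"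
  proof (rule dependent_nat_choice)
    obtain A where "A \<in> \<G>" "to_nat ([] :: nat list) \<le> lab A" using big by blast
    then show "\<exists>x. snd x \<in> \<G> \<and> to_nat (fst x :: nat list) \<le> lab (snd x) \<and> ((0::nat) = 0 \<longrightarrow> fst x = [])"
      by (intro exI[of _ "([], A)"]) auto
  next
    fix x :: "nat list \<times> 'a set" and n :: nat
    assume x: "snd x \<in> \<G> \<and> to_nat (fst x) \<le> lab (snd x) \<and> (n = 0 \<longrightarrow> fst x = [])"
    define t where "t = sg (snd x) (fst x) # fst x"
    have "F t \<subseteq> snd x"
      using x lab[of "snd x"] unfolding E_def t_def I_def by blast
    moreover obtain A where "A \<in> \<G>" "max (to_nat t) (Suc (lab (snd x))) \<le> lab A"
      using big by blast
    ultimately show "\<exists>y. (snd y \<in> \<G> \<and> to_nat (fst y) \<le> lab (snd y) \<and> (Suc n = 0 \<longrightarrow> fst y = []))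
      \<and> ((\<exists>m. fst y = m # fst x) \<and> F (fst y) \<subseteq> snd x \<and> lab (snd x) < lab (snd y))"
      by (intro exI[of _ "(t, A)"]) (auto simp: t_def)
  qed
  then obtain f where f: "\<And>n. snd (f n) \<in> \<G>" "fst (f 0) = []"
    "\<And>n. \<exists>m. fst (f (Suc n)) = m # fst (f n)" "\<And>n. F (fst (f (Suc n))) \<subseteq> snd (f n)"
    "\<And>n. lab (snd (f n)) < lab (snd (f (Suc n)))"
    by blast
  have "strict_mono (\<lambda>n. lab (snd (f n)))"
    using f(5) by (simp add: strict_mono_Suc_iff)
  then have inj: "n = n'" if "snd (f n) = snd (f n')" for n n'
    using that by (metis strict_mono_eq)
  show ?thesis
  proof (rule that[of "\<lambda>n. fst (f n)"])
    fix x assume "x \<in> topspace X"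
    then obtain V where V: "openin X V" "x \<in> V"
      "\<forall>A\<in>\<G>. \<forall>A'\<in>\<G>. V \<inter> P A \<noteq> {} \<longrightarrow> V \<inter> P A' \<noteq> {} \<longrightarrow> A = A'"
      using N by metis
    have "n = n'" if "V \<inter> F (fst (f (Suc n))) \<noteq> {}" "V \<inter> F (fst (f (Suc n'))) \<noteq> {}" for n n'
    proof -
      have "V \<inter> P (snd (f n)) \<noteq> {}" "V \<inter> P (snd (f n')) \<noteq> {}"
        using that f(4) P(2)[OF f(1)] by blast+
      then show ?thesis using V(3) f(1) inj by simp
    qed
    then have "{n. V \<inter> F (fst (f (Suc n))) \<noteq> {}} \<subseteq> {n0}"
      if "V \<inter> F (fst (f (Suc n0))) \<noteq> {}" for n0
      using that by blast
    then have "finite {n. V \<inter> F (fst (f (Suc n))) \<noteq> {}}"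
      by (metis (mono_tags, lifting) Collect_empty_eq finite.emptyI finite.insertI finite_subset)
    then show "\<exists>N. openin X N \<and> x \<in> N \<and> finite {n. N \<inter> F (fst (f (Suc n))) \<noteq> {}}"
      using V by blast
  qed (use f in auto)
qed

section \<open>The compact-open topology\<close>

text \<open>Basic sets for uniform convergence on \<open>K\<close>. The facts
  \<open>openin_Ck_space_ball\<close> and \<open>openin_Ck_ball\<close> show that over all compact
  \<open>K\<close> they describe the compact-open topology.\<close>

definition Ck_ball :: "'a topology \<Rightarrow> 'a set \<Rightarrow> ('a \<Rightarrow> real) \<Rightarrow> real \<Rightarrow> ('a \<Rightarrow> real) set" where
  "Ck_ball X K p e = {f \<in> real_continuous_functions X. \<forall>x\<in>K. \<bar>f x - p x\<bar> < e}"

lemma real_continuous_functions_restrict: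
  assumes "continuous_map X euclideanreal f"
  shows "restrict f (topspace X) \<in> real_continuous_functions X"
  unfolding real_continuous_functions_def
  using continuous_map_eq[OF assms, of "restrict f (topspace X)"] by auto

lemma Ck_subbasis:
  assumes "compactin X K" "open V"
  shows "openin (Ck_space X) {f \<in> real_continuous_functions X. f ` K \<subseteq> V}"
  unfolding Ck_space_def by (rule topology_generated_by_Basis) (use assms in blast)

lemma openin_Ck_space_ball:
  assumes "openin (Ck_space X) G" "f \<in> G"
  obtains K e where "compactin X K" "e > 0" "Ck_ball X K f e \<subseteq> G"
proof -
  have "generate_topology_on
      {{f \<in> real_continuous_functions X. f ` K \<subseteq> V} | K V. compactin X K \<and> open V} G"
    using assms(1) unfolding Ck_space_def by (rule openin_topology_generated_by)
  then have "\<forall>f\<in>G. \<exists>K e. compactin X K \<and> e > 0 \<and> Ck_ball X K f e \<subseteq> G"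
  proof induction
    case (Int A B)
    show ?case
    proof
      fix f assume f: "f \<in> A \<inter> B"
      then obtain K e L d where "compactin X K" "e > 0" "Ck_ball X K f e \<subseteq> A"
        "compactin X L" "d > 0" "Ck_ball X L f d \<subseteq> B"
        using Int by blast
      then show "\<exists>K e. compactin X K \<and> e > 0 \<and> Ck_ball X K f e \<subseteq> A \<inter> B"
        by (intro exI[of _ "K \<union> L"] exI[of _ "min e d"])
          (auto simp: Ck_ball_def compactin_Un subset_iff)
    qed
  next
    case (UN \<K>)
    then show ?case by (meson UnionE Union_upper order_trans)
  next
    case (Basis S)
    then obtain K V where S: "S = {f \<in> real_continuous_functions X. f ` K \<subseteq> V}"
      "compactin X K" "open V" by blast
    show ?case
    proof
      fix f assume f: "f \<in> S"
      then have "compact (f ` K)" "f ` K \<subseteq> V"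
        using S image_compactin[of X K euclideanreal f]
        by (auto simp: real_continuous_functions_def)
      then obtain e where e: "e > 0" "(\<Union>y\<in>f ` K. ball y e) \<subseteq> V"
        using compact_subset_open_imp_ball_epsilon_subset[OF _ \<open>open V\<close>] by metis
      have "Ck_ball X K f e \<subseteq> S"
      proof
        fix g assume g: "g \<in> Ck_ball X K f e"
        have "g x \<in> V" if "x \<in> K" for x
        proof -
          have "g x \<in> ball (f x) e"
            using g that by (auto simp: Ck_ball_def dist_real_def abs_minus_commute)
          then show ?thesis using e that by blast
        qed
        then show "g \<in> S" using g S by (auto simp: Ck_ball_def)
      qed
      then show "\<exists>K e. compactin X K \<and> e > 0 \<and> Ck_ball X K f e \<subseteq> S"
        using S e by blast
    qed
  qed simp
  then show ?thesis using assms that by blast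
qed

text \<open>By compactness \<open>f\<close> satisfies the defining inequality with a margin
  \<open>d\<close>. Splitting \<open>K\<close> into finitely many compact pieces on which
  \<open>f\<close> is nearly constant turns closeness to \<open>f\<close> into finitely many
  subbasic conditions.\<close>

lemma openin_Ck_ball:
  assumes K: "compactin X K" and p: "p \<in> real_continuous_functions X" and "e > 0"
  shows "openin (Ck_space X) (Ck_ball X K p e)"
proof (subst openin_subopen, intro ballI)
  fix f assume f: "f \<in> Ck_ball X K p e"
  have cf: "continuous_map X euclideanreal f" and cp: "continuous_map X euclideanreal p"
    using f p by (auto simp: Ck_ball_def real_continuous_functions_def)
  have "\<exists>d>0. \<forall>x\<in>K. \<bar>f x - p x\<bar> \<le> e - d"
  proof -
    have "compact ((\<lambda>x. \<bar>f x - p x\<bar>) ` K)"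
      using image_compactin[OF K continuous_map_real_abs[OF continuous_map_diff[OF cf cp]]] by simp
    moreover have "(\<lambda>x. \<bar>f x - p x\<bar>) ` K \<subseteq> {..<e}" using f by (auto simp: Ck_ball_def)
    ultimately show ?thesis
    proof (cases "K = {}")
      case False
      then obtain x where "x \<in> K" "\<forall>y\<in>K. \<bar>f y - p y\<bar> \<le> \<bar>f x - p x\<bar>"
        using compact_attains_sup[OF \<open>compact _\<close>] by auto
      then show ?thesis
        using f by (intro exI[of _ "e - \<bar>f x - p x\<bar>"]) (auto simp: Ck_ball_def)
    qed (auto intro: exI[of _ 1])
  qed
  then obtain d where d: "d > 0" "\<And>x. x \<in> K \<Longrightarrow> \<bar>f x - p x\<bar> \<le> e - d" by blast
  \<comment> \<open>On \<open>piece y\<close> the values of \<open>f\<close> and \<open>g\<close>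
    are within \<open>\<delta>\<close> and \<open>2 * \<delta>\<close> of \<open>y\<close>, and
    \<open>3 * \<delta> < d\<close>.\<close>
  define \<delta> where "\<delta> = d / 4"
  have \<delta>: "\<delta> > 0" using d by (simp add: \<delta>_def)
  define piece where "piece y = K \<inter> {x \<in> topspace X. f x \<in> cball y \<delta>}" for y
  have comp_piece: "compactin X (piece y)" for y
    unfolding piece_def
    using compact_Int_closedin[OF K closedin_continuous_map_preimage[OF cf, of "cball y \<delta>"]]
    by simp
  have "compact (f ` K)" using image_compactin[OF K cf] by simp
  then obtain Y where Y: "finite Y" "f ` K \<subseteq> (\<Union>y\<in>Y. ball y \<delta>)"
    using compactE_image[of "f ` K" UNIV "\<lambda>y. ball y \<delta>"] \<delta> by (metis UNIV_I UN_I centre_in_ball open_ball subsetI)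
  define B where "B y = {g \<in> real_continuous_functions X. g ` piece y \<subseteq> ball y (2 * \<delta>)}" for y
  \<comment> \<open>Intersecting with the whole space keeps \<open>T\<close> meaningful when
    \<open>Y\<close>, and hence \<open>K\<close>, is empty.\<close>
  define T where "T = topspace (Ck_space X) \<inter> (\<Inter>y\<in>Y. B y)"
  have fR: "f \<in> real_continuous_functions X" using f by (simp add: Ck_ball_def)
  have "openin (Ck_space X) T"
  proof (cases "Y = {}")
    case False
    have "openin (Ck_space X) (\<Inter>y\<in>Y. B y)"
      using Y(1) False Ck_subbasis[OF comp_piece] unfolding B_def
      by (intro openin_Inter) auto
    then show ?thesis unfolding T_def by blast
  qed (simp add: T_def)
  moreover have "f \<in> T"
    using fR \<delta> by (auto simp: T_def B_def piece_def topspace_Ck_space)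
  moreover have "T \<subseteq> Ck_ball X K p e"
  proof
    fix g assume g: "g \<in> T"
    then have gR: "g \<in> real_continuous_functions X" by (simp add: T_def topspace_Ck_space)
    have "\<bar>g x - p x\<bar> < e" if x: "x \<in> K" for x
    proof -
      obtain y where y: "y \<in> Y" "f x \<in> ball y \<delta>" using Y x by blast
      have "x \<in> piece y"
        using x y compactin_subset_topspace[OF K] unfolding piece_def by auto
      then have "g x \<in> ball y (2 * \<delta>)" using g y unfolding T_def B_def by blast
      then have "\<bar>g x - f x\<bar> < 3 * \<delta>" using y by (auto simp: dist_real_def)
      then show ?thesis using d(2)[OF x] d(1) unfolding \<delta>_def by linarith
    qed
    then show "g \<in> Ck_ball X K p e" using gR by (simp add: Ck_ball_def)
  qed
  ultimately show "\<exists>T. openin (Ck_space X) T \<and> f \<in> T \<and> T \<subseteq> Ck_ball X K p e" by blast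
qed

lemma centre_in_Ck_ball: "p \<in> real_continuous_functions X \<Longrightarrow> e > 0 \<Longrightarrow> p \<in> Ck_ball X K p e"
  by (simp add: Ck_ball_def)

lemma normal_space_separating_function:
  assumes "normal_space X" "closedin X S" "closedin X T" "S \<inter> T = {}"
  obtains \<phi> where "continuous_map X euclideanreal \<phi>" "\<And>x. x \<in> S \<Longrightarrow> \<phi> x = 0"
    "\<And>x. x \<in> T \<Longrightarrow> \<phi> x = 1" "\<And>x. x \<in> topspace X \<Longrightarrow> \<phi> x \<in> {0..1::real}"
proof -
  obtain \<phi> :: "'a \<Rightarrow> real" where "continuous_map X (top_of_set {0..1}) \<phi>"
    "\<phi> ` S \<subseteq> {0}" "\<phi> ` T \<subseteq> {1}"
    using Urysohn_lemma[OF assms(1-3), of 0 1] assms(4) by (auto simp: disjnt_def)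
  then show ?thesis
    by (intro that[of \<phi>]) (auto simp: continuous_map_in_subtopology)
qed

section \<open>From the Baire property to the Moving Off Property\<close>

lemma Baire_Ck_imp_moving_off_property:
  assumes normal: "normal_space X" and haus: "Hausdorff_space X"
    and Baire: "Baire_space (Ck_space X)"
  shows "moving_off_property X"
  unfolding moving_off_property_def
proof (intro allI impI, elim conjE)
  fix \<F>
  assume mov: "moving_off_family X \<F>" and comp: "\<forall>F\<in>\<F>. compactin X F"
  define W where "W n = (\<Union>F\<in>{F \<in> \<F>. F \<noteq> {}}. {f \<in> real_continuous_functions X. f ` F \<subseteq> {real n<..}})" for n
  have "openin (Ck_space X) (W n)" for n
    unfolding W_def using comp by (intro openin_Union) (auto intro!: Ck_subbasis)
  moreover have "Ck_space X closure_of (W n) = topspace (Ck_space X)" for n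
  proof (intro subset_antisym subsetI)
    fix f assume f: "f \<in> topspace (Ck_space X)"
    show "f \<in> Ck_space X closure_of W n"
      unfolding in_closure_of
    proof (intro conjI allI impI, fact f, elim conjE)
      fix T assume T: "f \<in> T" "openin (Ck_space X) T"
      obtain K e where K: "compactin X K" and e: "e > 0" "Ck_ball X K f e \<subseteq> T"
        using openin_Ck_space_ball[OF T(2,1)] .
      obtain F where F: "F \<in> \<F>" "F \<noteq> {}" "K \<inter> F = {}"
        using mov K unfolding moving_off_family_def by blast
      obtain \<phi> where \<phi>: "continuous_map X euclideanreal \<phi>" "\<And>x. x \<in> K \<Longrightarrow> \<phi> x = 0"
        "\<And>x. x \<in> F \<Longrightarrow> \<phi> x = 1"
        using normal_space_separating_function[OF normal, of K F] K F comp haus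
        by (metis compactin_imp_closedin)
      have cf: "continuous_map X euclideanreal f"
        using f by (simp add: topspace_Ck_space real_continuous_functions_def)
      \<comment> \<open>This interpolation equals \<open>f\<close> where \<open>\<phi>\<close> is 0
        and \<open>real n + 1\<close> where \<open>\<phi>\<close> is 1, so it stays in the ball and
        enters \<open>W n\<close>.\<close>
      define g where "g = restrict (\<lambda>x. f x + \<phi> x * (real n + 1 - f x)) (topspace X)"
      have gR: "g \<in> real_continuous_functions X"
        unfolding g_def using cf \<phi>(1)
        by (intro real_continuous_functions_restrict continuous_intros) auto
      have KF: "K \<subseteq> topspace X" "F \<subseteq> topspace X"
        using K F comp compactin_subset_topspace by blast+
      have "g \<in> Ck_ball X K f e"
        using gR \<phi>(2) e KF by (auto simp: Ck_ball_def g_def subset_iff)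
      moreover have "g x = real n + 1" if "x \<in> F" for x
        using that KF \<phi>(3) by (auto simp: g_def subset_iff)
      then have "g ` F \<subseteq> {real n<..}" by auto
      then have "g \<in> W n" unfolding W_def using F gR by blast
      ultimately show "\<exists>y. y \<in> W n \<and> y \<in> T" using e by blast
    qed
  qed (simp add: in_closure_of)
  ultimately have "Ck_space X closure_of (\<Inter>n. W n) = topspace (Ck_space X)"
    using Baire unfolding Baire_space_def by blast
  \<comment> \<open>The function space is non-empty, so its dense subset contains a
    function.\<close>
  moreover have "restrict (\<lambda>_. 0) (topspace X) \<in> topspace (Ck_space X)"
    unfolding topspace_Ck_space by (intro real_continuous_functions_restrict) auto
  ultimately obtain f where f: "f \<in> (\<Inter>n. W n)"
    by (metis closure_of_empty empty_iff equals0I)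
  then have cf: "continuous_map X euclideanreal f"
    unfolding W_def by (auto simp: real_continuous_functions_def)
  have "\<exists>F\<in>\<F>. F \<noteq> {} \<and> f ` F \<subseteq> {real n<..}" for n
    using f unfolding W_def by blast
  then obtain A where A: "\<And>n. A n \<in> \<F>" "\<And>n. A n \<noteq> {}" "\<And>n. f ` A n \<subseteq> {real n<..}" by metis
  have "\<exists>b. \<forall>x\<in>A n. f x < real b" for n
  proof -
    have "compact (f ` A n)" using image_compactin[of X "A n" euclideanreal f] cf A comp by simp
    then obtain B where "\<And>x. x \<in> A n \<Longrightarrow> f x \<le> B"
      using compact_imp_bounded bounded_has_Sup(1) A(2)
      by (metis image_eqI image_is_empty)
    then show ?thesis by (meson le_less_trans reals_Archimedean2)
  qed
  then obtain b where b: "\<And>n x. x \<in> A n \<Longrightarrow> f x < real (b n)" by metis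
  \<comment> \<open>The thresholds are chosen so that \<open>f\<close> maps \<open>F k\<close>
    strictly between \<open>c k + 1\<close> and \<open>c (Suc k)\<close>. Consecutive strips are
    thus separated by gaps of length 1.\<close>
  define c where "c = rec_nat 0 (\<lambda>_ n. b (n + 1))"
  define F where "F k = A (c k + 1)" for k
  have F: "real (c k) + 1 < f x" "f x < real (c (Suc k))" if "x \<in> F k" for k x
    using that A(3)[of "c k + 1"] b[of x "c k + 1"] by (auto simp: F_def c_def)
  have F_ne: "F k \<noteq> {}" for k by (simp add: F_def A)
  have c_step: "c k + 1 \<le> c (Suc k)" for k
  proof -
    obtain x where "x \<in> F k" using F_ne by blast
    then have "real (c k) + 1 < real (c (Suc k))" using F by fastforce
    then show ?thesis by linarith
  qed
  then have c_mono: "c i \<le> c j" if "i \<le> j" for i j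
    using lift_Suc_mono_le[of c, OF _ that] by (meson add_leD1)
  have inj: "inj F"
  proof (rule injI)
    fix i j assume eq: "F i = F j"
    obtain x where x: "x \<in> F i" "x \<in> F j" using F_ne eq by blast
    show "i = j"
    proof (rule ccontr)
      assume "i \<noteq> j"
      then consider "Suc i \<le> j" | "Suc j \<le> i" by linarith
      then show False
        using F[OF x(1)] F[OF x(2)] c_mono by cases fastforce+
    qed
  qed
  \<comment> \<open>Neighborhoods are indexed by sets, so \<open>inv F\<close> recovers the number
    of the strip; injectivity of \<open>F\<close> makes this number the right one.\<close>
  define P where "P B = {x \<in> topspace X. f x \<in> {real (c (inv F B)) + 1 <..< real (c (Suc (inv F B)))}}"
    for B
  have "strongly_discrete_family X (range F)"
    unfolding strongly_discrete_family_def
  proof (intro exI[of _ P] conjI ballI)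
    fix B assume "B \<in> range F"
    then obtain k where B: "B = F k" by blast
    then have k: "inv F B = k" using inj by simp
    show "openin X (P B)"
      unfolding P_def by (rule openin_continuous_map_preimage[OF cf]) simp
    have "F k \<subseteq> topspace X"
      using A comp compactin_subset_topspace unfolding F_def by blast
    then show "B \<subseteq> P B" unfolding P_def k using F B by auto
  next
    fix x assume x: "x \<in> topspace X"
    \<comment> \<open>Values of \<open>f\<close> on \<open>?N\<close> differ by less than 1, so
      \<open>?N\<close> cannot reach across a gap between strips.\<close>
    let ?N = "{y \<in> topspace X. f y \<in> {f x - 1/2 <..< f x + 1/2}}"
    have far: False if BB: "?N \<inter> P B \<noteq> {}" "?N \<inter> P B' \<noteq> {}" "Suc (inv F B) \<le> inv F B'" for B B'
    proof -
      obtain y where "y \<in> ?N" "y \<in> P B" using BB(1) by blast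
      moreover obtain y' where "y' \<in> ?N" "y' \<in> P B'" using BB(2) by blast
      ultimately have "f y < real (c (Suc (inv F B)))" "real (c (inv F B')) + 1 < f y'"
        "\<bar>f y - f x\<bar> < 1/2" "\<bar>f y' - f x\<bar> < 1/2"
        unfolding P_def by (simp_all add: abs_if)
      then show False using c_mono[OF BB(3)] by linarith
    qed
    have "B = B'"
      if "?N \<inter> P B \<noteq> {}" "?N \<inter> P B' \<noteq> {}" "B \<in> range F" "B' \<in> range F" for B B'
    proof (rule ccontr)
      assume "B \<noteq> B'"
      then have "inv F B \<noteq> inv F B'" using f_inv_into_f[OF that(3)] f_inv_into_f[OF that(4)] by force
      then consider "Suc (inv F B) \<le> inv F B'" | "Suc (inv F B') \<le> inv F B" by linarith
      then show False using far[OF that(1,2)] far[OF that(2,1)] by cases simp_all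
    qed
    moreover have "openin X ?N"
      by (rule openin_continuous_map_preimage[OF cf]) simp
    then have "neighborhood_in X x ?N"
      unfolding neighborhood_in_def using x by (intro conjI exI[of _ ?N]) auto
    ultimately show "\<exists>N. neighborhood_in X x N \<and> (\<forall>B\<in>range F. \<forall>B'\<in>range F.
        N \<inter> P B \<noteq> {} \<longrightarrow> N \<inter> P B' \<noteq> {} \<longrightarrow> B = B')" by blast
  qed
  moreover have "range F \<subseteq> \<F>" using A unfolding F_def by blast
  moreover have "infinite (range F)" using inj finite_imageD by blast
  ultimately show "\<exists>\<G>\<subseteq>\<F>. infinite \<G> \<and> strongly_discrete_family X \<G>" by blast
qed

section \<open>Refining balls into dense open sets\<close>

text \<open>Density gives \<open>r\<close> in \<open>G\<close> close to \<open>p\<close> on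
  \<open>K\<close>, with no control elsewhere. The difference \<open>r - p\<close> is truncated at
  \<open>e / 4\<close>, and its full size is restored only near the compact set \<open>F\<close> of
  points of \<open>K'\<close> where truncation could matter. Thus \<open>q\<close> agrees with
  \<open>r\<close> on \<open>K'\<close> but stays close to \<open>p\<close> outside
  \<open>V F\<close>.\<close>

lemma Ck_approximation_step:
  assumes normal: "normal_space X" and haus: "Hausdorff_space X"
    and p: "p \<in> real_continuous_functions X" and K: "compactin X K" and e: "e > 0"
    and G: "openin (Ck_space X) G" "Ck_space X closure_of G = topspace (Ck_space X)"
    and V: "\<And>F. compactin X F \<Longrightarrow> \<exists>W. openin X W \<and> F \<subseteq> W \<and> W \<subseteq> V F"
  obtains q K' e' F where "q \<in> real_continuous_functions X" "compactin X K'" "K \<subseteq> K'"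
    "0 < e'" "e' \<le> e / 2" "Ck_ball X K' q e' \<subseteq> G" "compactin X F" "F \<inter> K = {}"
    "\<And>x. x \<in> topspace X \<Longrightarrow> x \<in> K \<or> x \<notin> V F \<Longrightarrow> \<bar>q x - p x\<bar> \<le> e / 4"
proof -
  have "p \<in> Ck_space X closure_of G" using p G(2) by (simp add: topspace_Ck_space)
  moreover have "openin (Ck_space X) (Ck_ball X K p (e / 4))" "p \<in> Ck_ball X K p (e / 4)"
    using openin_Ck_ball[OF K p] centre_in_Ck_ball[OF p] e by auto
  ultimately obtain r where r: "r \<in> G" "r \<in> Ck_ball X K p (e / 4)"
    unfolding in_closure_of by blast
  obtain L \<epsilon> where L: "compactin X L" "\<epsilon> > 0" "Ck_ball X L r \<epsilon> \<subseteq> G"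
    using openin_Ck_space_ball[OF G(1) r(1)] .
  define K' where "K' = K \<union> L"
  have K': "compactin X K'" unfolding K'_def using K L by (simp add: compactin_Un)
  have K'_sub: "K' \<subseteq> topspace X" using K' compactin_subset_topspace by blast
  have cr: "continuous_map X euclideanreal r" and cp: "continuous_map X euclideanreal p"
    using r p by (auto simp: Ck_ball_def real_continuous_functions_def)
  define d where "d x = r x - p x" for x
  have cd: "continuous_map X euclideanreal d"
    unfolding d_def by (rule continuous_map_diff[OF cr cp])
  define F where "F = K' \<inter> {x \<in> topspace X. d x \<in> - {- (e / 4) <..< e / 4}}"
  have F: "compactin X F"
    unfolding F_def
    by (rule compact_Int_closedin[OF K' closedin_continuous_map_preimage[OF cd]]) auto
  have FK: "F \<inter> K = {}"
  proof -
    have "d x \<in> {- (e / 4) <..< e / 4}" if "x \<in> K" for x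
      using r(2) that unfolding d_def Ck_ball_def greaterThanLessThan_iff by (simp only: mem_Collect_eq) (metis abs_less_iff minus_less_iff)
    then show ?thesis unfolding F_def by blast
  qed
  obtain W where W: "openin X W" "F \<subseteq> W" "W \<subseteq> V F" using V[OF F] by blast
  \<comment> \<open>Removing \<open>K\<close> keeps the full correction away from \<open>K\<close>
    even if \<open>V F\<close> meets it.\<close>
  define Q where "Q = W - K"
  have "openin X Q"
    unfolding Q_def using W(1) compactin_imp_closedin[OF haus K] by (rule openin_diff)
  then have "closedin X (topspace X - Q)" by blast
  moreover have "(topspace X - Q) \<inter> F = {}" using W(2) FK unfolding Q_def by blast
  ultimately obtain \<phi> where \<phi>: "continuous_map X euclideanreal \<phi>"
    "\<And>x. x \<in> topspace X - Q \<Longrightarrow> \<phi> x = 0" "\<And>x. x \<in> F \<Longrightarrow> \<phi> x = 1"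
    using normal_space_separating_function[OF normal _ compactin_imp_closedin[OF haus F]] by metis
  define c where "c x = max (- (e / 4)) (min (e / 4) (d x))" for x
  have cc: "continuous_map X euclideanreal c"
    unfolding c_def by (intro continuous_intros cd) auto
  \<comment> \<open>On \<open>F\<close> this is \<open>p + d = r\<close>, outside \<open>Q\<close>
    it is \<open>p + c\<close>, and on the rest of \<open>K'\<close> the truncation \<open>c\<close>
    equals \<open>d\<close>.\<close>
  define q where "q = restrict (\<lambda>x. p x + c x + \<phi> x * (d x - c x)) (topspace X)"
  have q: "q \<in> real_continuous_functions X"
    unfolding q_def using cp cc \<phi>(1) cd
    by (intro real_continuous_functions_restrict continuous_map_add continuous_map_real_mult
        continuous_map_diff)
  have q_eq: "q x = r x" if "x \<in> K'" for x
  proof (cases "x \<in> F")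
    case True
    then show ?thesis using that K'_sub \<phi>(3) by (auto simp: q_def d_def)
  next
    case False
    then have "c x = d x"
      using that K'_sub unfolding F_def c_def by auto
    then show ?thesis using that K'_sub by (auto simp: q_def d_def)
  qed
  show thesis
  proof (rule that[OF q K'])
    show "K \<subseteq> K'" "F \<inter> K = {}" "compactin X F" using FK F by (auto simp: K'_def)
    show "0 < min \<epsilon> (e / 2)" "min \<epsilon> (e / 2) \<le> e / 2" using L(2) e by auto
    show "Ck_ball X K' q (min \<epsilon> (e / 2)) \<subseteq> G"
      using L(3) q_eq unfolding Ck_ball_def K'_def by auto
    fix x assume x: "x \<in> topspace X" "x \<in> K \<or> x \<notin> V F"
    then have "x \<notin> Q" using W(3) unfolding Q_def by blast
    then have "q x - p x = c x" using x \<phi>(2) by (simp add: q_def)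
    then show "\<bar>q x - p x\<bar> \<le> e / 4" using e by (auto simp: c_def abs_le_iff)
  qed
qed

text \<open>A triple \<open>(p, K, e)\<close> stands for the ball
  \<open>Ck_ball X K p e\<close>.\<close>

definition Ck_condition :: "'a topology \<Rightarrow> ('a \<Rightarrow> real) \<times> 'a set \<times> real \<Rightarrow> bool" where
  "Ck_condition X = (\<lambda>(p, K, e). p \<in> real_continuous_functions X \<and> compactin X K \<and> e > 0)"

text \<open>\<open>F\<close> is the exceptional set of the step and \<open>V F\<close> its
  neighborhood, outside which the centre barely moves. Closeness on \<open>K\<close> within
  \<open>e / 4\<close> and the halved radius make the new ball lie in the old one.\<close>

definition Ck_refines :: "'a topology \<Rightarrow> ('a set \<Rightarrow> 'a set) \<Rightarrow> ('a \<Rightarrow> real) set \<Rightarrow>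
    ('a \<Rightarrow> real) \<times> 'a set \<times> real \<Rightarrow> ('a \<Rightarrow> real) \<times> 'a set \<times> real \<Rightarrow> 'a set \<Rightarrow> bool" where
  "Ck_refines X V G = (\<lambda>(p, K, e) (q, K', e') F.
     Ck_condition X (q, K', e') \<and> K \<subseteq> K' \<and> e' \<le> e / 2 \<and> Ck_ball X K' q e' \<subseteq> G \<and>
     compactin X F \<and> (\<forall>x\<in>topspace X. x \<in> K \<or> x \<notin> V F \<longrightarrow> \<bar>q x - p x\<bar> \<le> e / 4))"

text \<open>If \<open>F = {}\<close> is never possible, the sets \<open>F\<close> of all refinements form a moving off family:
  to avoid \<open>L\<close>, refine the condition with compact set \<open>K \<union> L\<close>.\<close>

lemma Ck_refinement_children:
  assumes normal: "normal_space X" and haus: "Hausdorff_space X"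
    and MOP: "moving_off_property X"
    and G: "openin (Ck_space X) G" "Ck_space X closure_of G = topspace (Ck_space X)"
    and V: "\<And>F. compactin X F \<Longrightarrow> \<exists>W. openin X W \<and> F \<subseteq> W \<and> W \<subseteq> V F"
    and s: "Ck_condition X s"
  obtains c where "\<And>m. Ck_refines X V G s (fst (c m)) (snd (c m))"
    "\<And>L. compactin X L \<Longrightarrow> finite {m::nat. L \<inter> snd (c m) \<noteq> {}}"
proof (cases "\<exists>s'. Ck_refines X V G s s' {}")
  case True
  then obtain s' where "Ck_refines X V G s s' {}" by blast
  \<comment> \<open>One refinement with empty exceptional set, repeated for every \<open>m\<close>,
    meets no compact set.\<close>
  then show ?thesis by (intro that[of "\<lambda>_. (s', {})"]) auto
next
  case False
  obtain p K e where s_eq: "s = (p, K, e)" by (cases s)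
  have pKe: "p \<in> real_continuous_functions X" "compactin X K" "e > 0"
    using s by (auto simp: s_eq Ck_condition_def)
  define \<F> where "\<F> = {F. \<exists>s'. Ck_refines X V G s s' F}"
  have comp: "compactin X F" if "F \<in> \<F>" for F
    using that by (auto simp: \<F>_def Ck_refines_def split: prod.splits)
  have "moving_off_family X \<F>"
    unfolding moving_off_family_def
  proof (intro conjI ballI allI impI)
    show "F \<subseteq> topspace X" if "F \<in> \<F>" for F
      using comp[OF that] by (rule compactin_subset_topspace)
  next
    fix L assume "compactin X L"
    then have "compactin X (K \<union> L)" using pKe by (simp add: compactin_Un)
    then obtain q K' e' F where q: "q \<in> real_continuous_functions X" "compactin X K'" "K \<union> L \<subseteq> K'"
      "0 < e'" "e' \<le> e / 2" "Ck_ball X K' q e' \<subseteq> G" "compactin X F" "F \<inter> (K \<union> L) = {}"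
      "\<And>x. x \<in> topspace X \<Longrightarrow> x \<in> K \<union> L \<or> x \<notin> V F \<Longrightarrow> \<bar>q x - p x\<bar> \<le> e / 4"
      using Ck_approximation_step[OF normal haus pKe(1) _ pKe(3) G V] by metis
    then have "Ck_refines X V G s (q, K', e') F"
      unfolding s_eq Ck_refines_def Ck_condition_def by auto
    moreover from this have "F \<noteq> {}" using False by blast
    ultimately show "\<exists>F\<in>\<F>. F \<noteq> {} \<and> L \<inter> F = {}" using q(8) unfolding \<F>_def by blast
  qed
  then obtain \<G> where \<G>: "\<G> \<subseteq> \<F>" "infinite \<G>" "strongly_discrete_family X \<G>"
    using moving_off_propertyE[OF MOP] comp by metis
  obtain A :: "nat \<Rightarrow> 'a set" where A: "inj A" "range A \<subseteq> \<G>"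
    using infinite_countable_subset[OF \<G>(2)] by blast
  have "\<exists>s'. Ck_refines X V G s s' (A m)" for m
    using A(2) \<G>(1) unfolding \<F>_def by blast
  \<comment> \<open>The sets \<open>A m\<close> are distinct members of a strongly discrete family,
    so a compact set meets only finitely many of them.\<close>
  then obtain g where g: "\<And>m. Ck_refines X V G s (g m) (A m)" by metis
  have "finite {m. L \<inter> A m \<noteq> {}}" if "compactin X L" for L
  proof (rule finite_subset)
    show "{m. L \<inter> A m \<noteq> {}} \<subseteq> A -` {F \<in> \<G>. L \<inter> F \<noteq> {}}" using A(2) by auto
    show "finite (A -` {F \<in> \<G>. L \<inter> F \<noteq> {}})"
      using strongly_discrete_compact_finite[OF \<G>(3) that] A(1) by (rule finite_vimageI)
  qed
  then show ?thesis using g by (intro that[of "\<lambda>m. (g m, A m)"]) auto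
qed

section \<open>Limits of the sequence of centres\<close>

text \<open>Halving gives \<open>e n / 4 \<le> e n / 2 - e (Suc n) / 2\<close>, so the errors
  telescope. The start \<open>M\<close> allows for points that escape the exceptional neighborhoods
  only from some stage on.\<close>

lemma halving_errors_limit:
  fixes a e :: "nat \<Rightarrow> real"
  assumes a: "\<And>n. n \<ge> M \<Longrightarrow> \<bar>a (Suc n) - a n\<bar> \<le> e n / 4"
    and e: "\<And>n. e (Suc n) \<le> e n / 2" "\<And>n. 0 < e n" "e \<longlonglongrightarrow> 0"
    and n: "n \<ge> M"
  shows "\<bar>lim a - a n\<bar> \<le> e n / 2"
proof -
  have bound: "\<bar>a (n + k) - a n\<bar> \<le> e n / 2 - e (n + k) / 2" if "n \<ge> M" for n k
  proof (induction k)
    case (Suc k)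
    then show ?case using a[of "n + k"] e(1)[of "n + k"] that unfolding add_Suc_right by linarith
  qed simp
  then have bound': "\<bar>a m - a n\<bar> \<le> e n / 2" if "n \<ge> M" "m \<ge> n" for m n
  proof -
    obtain k where "m = n + k" using le_Suc_ex[OF \<open>m \<ge> n\<close>] by blast
    then show ?thesis using bound[OF that(1), of k] e(2)[of m] by simp
  qed
  have "Cauchy a"
  proof (rule metric_CauchyI)
    fix \<epsilon> :: real assume "\<epsilon> > 0"
    then have "\<forall>\<^sub>F n in sequentially. e n < \<epsilon>" by (rule order_tendstoD(2)[OF e(3)])
    then obtain N where N: "e N < \<epsilon>" "N \<ge> M"
      unfolding eventually_sequentially by (meson nle_le)
    have "dist (a m) (a k) < \<epsilon>" if "m \<ge> N" "k \<ge> N" for m k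
      using bound'[OF N(2) that(1)] bound'[OF N(2) that(2)] N(1)
      unfolding dist_real_def by linarith
    then show "\<exists>N. \<forall>m\<ge>N. \<forall>k\<ge>N. dist (a m) (a k) < \<epsilon>" by blast
  qed
  then have "a \<longlonglongrightarrow> lim a" using Cauchy_convergent_iff convergent_LIMSEQ_iff by blast
  then have "(\<lambda>m. \<bar>a m - a n\<bar>) \<longlonglongrightarrow> \<bar>lim a - a n\<bar>" by (intro tendsto_intros)
  then show ?thesis
    by (rule LIMSEQ_le_const2) (use bound'[OF n] in blast)
qed

text \<open>The usual argument with thirds of \<open>\<epsilon>\<close>, where the stage from which
  the estimate holds may depend on the point.\<close>

lemma continuous_map_local_uniform_limit:
  fixes f :: "'a \<Rightarrow> real"
  assumes p: "\<And>n. continuous_map X euclideanreal (p n)" and e: "e \<longlonglongrightarrow> (0::real)"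
    and lim: "\<And>x. x \<in> topspace X \<Longrightarrow>
      \<exists>N M. openin X N \<and> x \<in> N \<and> (\<forall>n\<ge>M. \<forall>y\<in>N. \<bar>f y - p n y\<bar> \<le> e n)"
  shows "continuous_map X euclideanreal f"
  unfolding continuous_map
proof (intro conjI allI impI)
  fix S :: "real set" assume "openin euclideanreal S"
  then have S: "open S" by simp
  show "openin X {x \<in> topspace X. f x \<in> S}"
  proof (subst openin_subopen, intro ballI)
    fix x assume x: "x \<in> {x \<in> topspace X. f x \<in> S}"
    then obtain \<epsilon> where \<epsilon>: "\<epsilon> > 0" "ball (f x) \<epsilon> \<subseteq> S"
      using openE[OF S, of "f x"] by (metis mem_Collect_eq)
    obtain N M where N: "openin X N" "x \<in> N" "\<And>n y. n \<ge> M \<Longrightarrow> y \<in> N \<Longrightarrow> \<bar>f y - p n y\<bar> \<le> e n"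
      using lim[of x] x by (metis (mono_tags, lifting) mem_Collect_eq)
    have "\<forall>\<^sub>F n in sequentially. e n < \<epsilon> / 3"
      by (rule order_tendstoD(2)[OF e]) (use \<epsilon>(1) in simp)
    then obtain n where n: "e n < \<epsilon> / 3" "n \<ge> M"
      unfolding eventually_sequentially by (meson nle_le)
    let ?T = "N \<inter> {y \<in> topspace X. p n y \<in> ball (p n x) (\<epsilon> / 3)}"
    have "openin X ?T"
      using openin_continuous_map_preimage[OF p, of "ball (p n x) (\<epsilon> / 3)"] N(1)
      by (intro openin_Int) auto
    moreover have "x \<in> ?T" using x N(2) \<epsilon>(1) by auto
    moreover have "?T \<subseteq> {x \<in> topspace X. f x \<in> S}"
    proof
      fix y assume y: "y \<in> ?T"
      then have "\<bar>p n x - p n y\<bar> < \<epsilon> / 3" by (simp add: dist_real_def)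
      moreover have "\<bar>f x - p n x\<bar> \<le> e n" "\<bar>f y - p n y\<bar> \<le> e n"
        using N(3)[OF n(2)] N(2) y by auto
      ultimately have "\<bar>f x - f y\<bar> < \<epsilon>" using n(1) by linarith
      then have "f y \<in> ball (f x) \<epsilon>" by (simp add: dist_real_def)
      then show "y \<in> {x \<in> topspace X. f x \<in> S}" using \<epsilon>(2) y by auto
    qed
    ultimately show "\<exists>T. openin X T \<and> x \<in> T \<and> T \<subseteq> {x \<in> topspace X. f x \<in> S}" by blast
  qed
qed simp

text \<open>The index of the neighborhood \<open>U n\<close> grows with \<open>n\<close>: a point off the closed set
  \<open>C = (\<Union>n\<ge>M. A n)\<close> has a neighborhood missing all of \<open>U k\<close> over \<open>C\<close> for one \<open>k\<close>, hence
  \<open>U n\<close> over \<open>A n\<close> for all large \<open>n\<close>.\<close>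

lemma stratification_locally_finite_expansion:
  assumes U: "stratification X U" and A: "\<And>n. closedin X (A n)"
    and fin: "\<And>x. x \<in> topspace X \<Longrightarrow> \<exists>N. openin X N \<and> x \<in> N \<and> finite {n. N \<inter> A n \<noteq> {}}"
    and x: "x \<in> topspace X"
  obtains N M where "openin X N" "x \<in> N" "\<And>n. n \<ge> M \<Longrightarrow> N \<inter> (\<Union>a\<in>A n. U n a) = {}"
proof -
  obtain N1 where N1: "x \<in> N1" "finite {n. N1 \<inter> A n \<noteq> {}}" using fin[OF x] by blast
  then obtain M1 where M1: "\<And>n. N1 \<inter> A n \<noteq> {} \<Longrightarrow> n < M1"
    using finite_nat_set_iff_bounded by auto
  \<comment> \<open>Only the tail is united, so that \<open>x\<close> lies outside \<open>C\<close>;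
    local finiteness makes \<open>C\<close> closed.\<close>
  define C where "C = (\<Union>n\<in>{M1..}. A n)"
  have A_sub: "A n \<subseteq> topspace X" for n using A closedin_subset by blast
  have "closedin X C"
    unfolding C_def
  proof (rule closedin_locally_finite_Union)
    show "locally_finite_in X (A ` {M1..})"
      unfolding locally_finite_in_def
    proof (intro conjI ballI)
      fix y assume "y \<in> topspace X"
      then obtain N where N: "openin X N" "y \<in> N" "finite {n. N \<inter> A n \<noteq> {}}"
        using fin by blast
      have "{B \<in> A ` {M1..}. B \<inter> N \<noteq> {}} \<subseteq> A ` {n. N \<inter> A n \<noteq> {}}" by blast
      then have "finite {B \<in> A ` {M1..}. B \<inter> N \<noteq> {}}"
        using N(3) finite_subset by blast
      then show "\<exists>N. openin X N \<and> y \<in> N \<and> finite {B \<in> A ` {M1..}. B \<inter> N \<noteq> {}}"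
        using N by blast
    qed (use A_sub in blast)
  qed (use A in blast)
  moreover have "x \<notin> C" using N1(1) M1 unfolding C_def by fastforce
  ultimately obtain k where k: "x \<notin> X closure_of (\<Union>a\<in>C. U k a)"
    using stratification_separates[OF U] by metis
  have C_sub: "C \<subseteq> topspace X" using A_sub unfolding C_def by blast
  have "U k a \<subseteq> topspace X" if "a \<in> C" for a
    using U that C_sub unfolding stratification_def neighborhood_in_def by blast
  then have cl: "(\<Union>a\<in>C. U k a) \<subseteq> X closure_of (\<Union>a\<in>C. U k a)"
    by (intro closure_of_subset) blast
  show thesis
  proof (rule that)
    show "openin X (topspace X - X closure_of (\<Union>a\<in>C. U k a))" by (simp add: openin_diff)
    show "x \<in> topspace X - X closure_of (\<Union>a\<in>C. U k a)" using x k by blast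
    fix n assume n: "n \<ge> max M1 k"
    have "(\<Union>a\<in>A n. U n a) \<subseteq> (\<Union>a\<in>A n. U k a)"
      using stratification_antimono[OF U A_sub] n by simp
    also have "\<dots> \<subseteq> (\<Union>a\<in>C. U k a)" using n unfolding C_def by auto
    finally show "(topspace X - X closure_of (\<Union>a\<in>C. U k a)) \<inter> (\<Union>a\<in>A n. U n a) = {}"
      using cl by blast
  qed
qed

section \<open>From the Moving Off Property to the Baire property\<close>

lemma moving_off_property_imp_Baire_Ck:
  assumes strat: "stratifiable_space X" and MOP: "moving_off_property X"
  shows "Baire_space (Ck_space X)"
  unfolding Baire_space_def
proof (intro allI impI subset_antisym subsetI)
  fix G :: "nat \<Rightarrow> ('a \<Rightarrow> real) set" and h
  assume G: "\<forall>n. openin (Ck_space X) (G n) \<and> Ck_space X closure_of G n = topspace (Ck_space X)"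
    and h: "h \<in> topspace (Ck_space X)"
  have normal: "normal_space X" and haus: "Hausdorff_space X"
    using strat by (simp_all add: stratifiable_imp_normal_space stratifiable_imp_Hausdorff_space)
  obtain U where U: "stratification X U" using stratifiable_spaceE[OF strat] .
  define V where "V n F = (\<Union>x\<in>F. U n x)" for n F
  have V: "\<exists>W. openin X W \<and> F \<subseteq> W \<and> W \<subseteq> V n F" if "compactin X F" for n F
    unfolding V_def
    by (rule stratification_interior[OF U compactin_subset_topspace[OF that]]) blast
  show "h \<in> Ck_space X closure_of (\<Inter>n. G n)"
    unfolding in_closure_of
  proof (intro conjI allI impI, fact h, elim conjE)
    fix T assume T: "h \<in> T" "openin (Ck_space X) T"
    obtain K0 e0 where K0: "compactin X K0" "e0 > 0" "Ck_ball X K0 h e0 \<subseteq> T"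
      using openin_Ck_space_ball[OF T(2,1)] .
    have s0: "Ck_condition X (h, K0, e0)"
      using h K0 by (simp add: Ck_condition_def topspace_Ck_space)
    define children where "children n s c \<longleftrightarrow>
        (\<forall>m. Ck_refines X (V n) (G n) s (fst (c m)) (snd (c m))) \<and>
        (\<forall>L. compactin X L \<longrightarrow> finite {m::nat. L \<inter> snd (c m) \<noteq> {}})" for n s c
    \<comment> \<open>A fixed choice for each stage and condition makes the tree definable by
      recursion on lists.\<close>
    define ch where "ch n s = (SOME c. children n s c)" for n s
    have "\<exists>c. children n s c" if "Ck_condition X s" for n s
      unfolding children_def
      by (rule Ck_refinement_children[OF normal haus MOP _ _ V[of _ n] that, where G = "G n"])
        (use G in auto)
    then have ch: "children n s (ch n s)" if "Ck_condition X s" for n s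
      unfolding ch_def using that by (metis someI_ex)
    \<comment> \<open>A list records the choices with the latest first, and its length is the stage.
      The root carries \<open>{}\<close> as a placeholder exceptional set.\<close>
    define node where "node = rec_list ((h, K0, e0), {}) (\<lambda>m t r. ch (length t) (fst r) m)"
    have node: "node [] = ((h, K0, e0), {})" "node (m # t) = ch (length t) (fst (node t)) m" for m t
      by (simp_all add: node_def)
    have cond: "Ck_condition X (fst (node t))" for t
    proof (induction t)
      case (Cons m t)
      then have "Ck_refines X (V (length t)) (G (length t)) (fst (node t))
          (fst (node (m # t))) (snd (node (m # t)))"
        using ch[OF Cons.IH] unfolding node children_def by simp
      then show ?case by (auto simp: Ck_refines_def split: prod.splits)
    qed (simp add: node s0)
    have ref: "Ck_refines X (V (length t)) (G (length t)) (fst (node t))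
        (fst (node (m # t))) (snd (node (m # t)))" for m t
      using ch[OF cond] unfolding node children_def by simp
    have fin: "finite {m. L \<inter> snd (node (m # t)) \<noteq> {}}" if "compactin X L" for L t
      using ch[OF cond] that unfolding node children_def by simp
    have comp: "compactin X (snd (node t))" for t
    proof (cases t)
      case (Cons m u)
      then show ?thesis using ref[of u m] by (auto simp: Ck_refines_def split: prod.splits)
    qed (simp add: node)
    obtain b where b: "b 0 = []" "\<And>n. \<exists>m. b (Suc n) = m # b n"
      "\<And>x. x \<in> topspace X \<Longrightarrow> \<exists>N. openin X N \<and> x \<in> N \<and> finite {n. N \<inter> snd (node (b (Suc n))) \<noteq> {}}"
      by (rule moving_off_property_branch[OF MOP comp fin], assumption) (rule that)
    have len: "length (b n) = n" for n
    proof (induction n)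
      case (Suc n)
      then show ?case using b(2)[of n] by auto
    qed (simp add: b)
    define p where "p n = fst (fst (node (b n)))" for n
    define K where "K n = fst (snd (fst (node (b n))))" for n
    define e where "e n = snd (snd (fst (node (b n))))" for n
    \<comment> \<open>\<open>A n\<close> belongs to the step from stage \<open>n\<close> to
      \<open>Suc n\<close>, hence is stored at the later node.\<close>
    define A where "A n = snd (node (b (Suc n)))" for n
    have pKe: "fst (node (b n)) = (p n, K n, e n)" for n by (simp add: p_def K_def e_def)
    have step: "Ck_refines X (V n) (G n) (p n, K n, e n) (p (Suc n), K (Suc n), e (Suc n)) (A n)" for n
    proof -
      obtain m where m: "b (Suc n) = m # b n" using b(2) by blast
      show ?thesis using ref[of "b n" m] by (simp add: m[symmetric] pKe A_def len)
    qed
    have p: "p n \<in> real_continuous_functions X" and e_pos: "e n > 0" for n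
      using cond[of "b n"] by (auto simp: pKe Ck_condition_def)
    have K_Suc: "K n \<subseteq> K (Suc n)" and e_Suc: "e (Suc n) \<le> e n / 2"
      and ball: "Ck_ball X (K (Suc n)) (p (Suc n)) (e (Suc n)) \<subseteq> G n"
      and A: "compactin X (A n)"
      and p_Suc: "\<And>x. x \<in> topspace X \<Longrightarrow> x \<in> K n \<or> x \<notin> V n (A n) \<Longrightarrow> \<bar>p (Suc n) x - p n x\<bar> \<le> e n / 4"
      for n
      using step[of n] by (auto simp: Ck_refines_def)
    have K_mono: "K m \<subseteq> K n" if "m \<le> n" for m n
      using lift_Suc_mono_le[of K, OF K_Suc that] .
    have K_sub: "K n \<subseteq> topspace X" for n
      using cond[of "b n"] compactin_subset_topspace by (auto simp: pKe Ck_condition_def)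
    have e_bound: "e n \<le> e 0 * (1 / 2) ^ n" for n
    proof (induction n)
      case (Suc n)
      then show ?case using e_Suc[of n] by simp
    qed simp
    have e_lim: "e \<longlonglongrightarrow> 0"
    proof (rule tendsto_sandwich[OF _ _ tendsto_const])
      show "(\<lambda>n. e 0 * (1 / 2) ^ n) \<longlonglongrightarrow> 0"
        by (intro tendsto_mult_right_zero LIMSEQ_realpow_zero) auto
    qed (use e_bound e_pos in \<open>auto intro!: always_eventually less_imp_le\<close>)
    define f where "f x = lim (\<lambda>n. p n x)" for x
    have f_K: "\<bar>f x - p n x\<bar> \<le> e n / 2" if "x \<in> K n" for x n
      unfolding f_def
    proof (rule halving_errors_limit[OF _ e_Suc e_pos e_lim order_refl])
      fix m assume "n \<le> m"
      then show "\<bar>p (Suc m) x - p m x\<bar> \<le> e m / 4"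
        using p_Suc[of x m] that K_mono K_sub by blast
    qed
    have "continuous_map X euclideanreal f"
    proof (rule continuous_map_local_uniform_limit[of _ p "\<lambda>n. e n / 2"])
      show "continuous_map X euclideanreal (p n)" for n
        using p by (simp add: real_continuous_functions_def)
      show "(\<lambda>n. e n / 2) \<longlonglongrightarrow> 0" using tendsto_divide_zero[OF e_lim] .
      fix x assume x: "x \<in> topspace X"
      \<comment> \<open>Near \<open>x\<close> the neighborhoods \<open>V n (A n)\<close> disappear
        from stage \<open>M\<close> on, so all later errors there are controlled uniformly.\<close>
      obtain N M where N: "openin X N" "x \<in> N" "\<And>n. n \<ge> M \<Longrightarrow> N \<inter> (\<Union>a\<in>A n. U n a) = {}"
        by (rule stratification_locally_finite_expansion[OF U compactin_imp_closedin[OF haus A]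
              b(3)[folded A_def] x], assumption) (rule that)
      have "\<bar>f y - p n y\<bar> \<le> e n / 2" if "n \<ge> M" "y \<in> N" for n y
        unfolding f_def
      proof (rule halving_errors_limit[OF _ e_Suc e_pos e_lim that(1)])
        fix m assume "M \<le> m"
        then show "\<bar>p (Suc m) y - p m y\<bar> \<le> e m / 4"
          using p_Suc[of y m] N(3)[of m] \<open>y \<in> N\<close> openin_subset[OF N(1)]
          unfolding V_def by blast
      qed
      then show "\<exists>N M. openin X N \<and> x \<in> N \<and> (\<forall>n\<ge>M. \<forall>y\<in>N. \<bar>f y - p n y\<bar> \<le> e n / 2)"
        using N by blast
    qed
    then have g: "restrict f (topspace X) \<in> real_continuous_functions X"
      by (rule real_continuous_functions_restrict)
    have g_ball: "restrict f (topspace X) \<in> Ck_ball X (K n) (p n) (e n)" for n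
    proof -
      have "\<bar>f x - p n x\<bar> < e n" if "x \<in> K n" for x
        using f_K[OF that] e_pos[of n] by linarith
      then show ?thesis using g K_sub[of n] by (auto simp: Ck_ball_def subset_iff)
    qed
    \<comment> \<open>The ball of stage \<open>Suc n\<close> lies in \<open>G n\<close>; stage 0 is
      reserved for the ball inside \<open>T\<close>.\<close>
    have "restrict f (topspace X) \<in> G n" for n
      using g_ball[of "Suc n"] ball[of n] by blast
    moreover have "p 0 = h" "K 0 = K0" "e 0 = e0"
      by (simp_all add: p_def K_def e_def b node)
    then have "restrict f (topspace X) \<in> T" using g_ball[of 0] K0(3) by auto
    ultimately show "\<exists>y. y \<in> (\<Inter>n. G n) \<and> y \<in> T" by blast
  qed
qed (simp add: in_closure_of)

section \<open>The equivalence and its transfer to the non-isolated points\<close>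

lemma Baire_Ck_iff_moving_off_property:
  assumes "stratifiable_space X"
  shows "Baire_space (Ck_space X) \<longleftrightarrow> moving_off_property X"
  using assms Baire_Ck_imp_moving_off_property moving_off_property_imp_Baire_Ck
    stratifiable_imp_normal_space stratifiable_imp_Hausdorff_space by blast

lemma closedin_nonisolated_points:
  "closedin X {x \<in> topspace X. \<not> isolated_point_in X x}"
proof -
  let ?I = "{x. isolated_point_in X x}"
  have "openin X (\<Union>x\<in>?I. {x})"
    by (intro openin_Union) (auto simp: isolated_point_in_def)
  then have "closedin X (topspace X - ?I)" by auto
  then show ?thesis by (simp add: set_diff_eq)
qed

theorem theorem1p2:
  fixes X :: "'a topology"
  assumes "stratifiable_space X"
  shows "Baire_space (Ck_space X) \<longleftrightarrow>
           moving_off_property X \<and> Baire_space (Ck_space (nonisolated_subspace X))"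
proof -
  have "stratifiable_space (nonisolated_subspace X)"
    unfolding nonisolated_subspace_def
    using assms closedin_nonisolated_points by (rule stratifiable_space_closed_subtopology)
  moreover have "moving_off_property (nonisolated_subspace X)" if "moving_off_property X"
    unfolding nonisolated_subspace_def
    using that closedin_nonisolated_points by (rule moving_off_property_closed_subtopology)
  \<comment> \<open>The equivalence is applied to \<open>X\<close> and to
    \<open>nonisolated_subspace X\<close>; the second conjunct then follows from the first.\<close>
  ultimately show ?thesis
    using assms Baire_Ck_iff_moving_off_property by blast
qed

end
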